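(* There exists an absolute constant $c_0>0$ such that for every positive integer $k$ there is a constant $\epsilon_k\ge c_0/k^2$ and an integer $n_k$ such that the following holds. Every finite point set $P$ in the plane $\mathbb{R}^2$ in general position with $|P|\ge n_k$ contains $2k$ pairwise disjoint subsets $A_1,\dots,A_k,B_1,\dots,B_k$, each of size at least $\epsilon_k|P|$, such that every pair of sets $A=\{a_1,\dots,a_k\}$ and $B=\{b_1,\dots,b_k\}$, with $a_i\in A_i$ and $b_i\in B_i$ for all $i$, is mutually avoiding.
   Context: A point set in $\mathbb{R}^2$ is in \emph{general position} if no three of its points are collinear. Two finite point sets $A,B\subset\mathbb{R}^2$ are \emph{mutually avoiding} if no line through two distinct points of $A$ intersects the convex hull of $B$, and no line through two distinct points of $B$ intersects the convex hull of $A$. *)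

theory Defs
  imports "HOL-Analysis.Analysis"
begin

definition general_position :: "(real^2) set \<Rightarrow> bool" where
  "general_position P \<longleftrightarrow>
     (\<forall>x\<in>P. \<forall>y\<in>P. \<forall>z\<in>P. x \<noteq> y \<and> y \<noteq> z \<and> x \<noteq> z \<longrightarrow> \<not> collinear {x, y, z})"

(* affine hull {x, y} is the line through x and y when x and y are distinct. *)
definition mutually_avoiding :: "(real^2) set \<Rightarrow> (real^2) set \<Rightarrow> bool" where
  "mutually_avoiding A B \<longleftrightarrow>
     (\<forall>x\<in>A. \<forall>y\<in>A. x \<noteq> y \<longrightarrow> affine hull {x, y} \<inter> convex hull B = {}) \<and>
     (\<forall>x\<in>B. \<forall>y\<in>B. x \<noteq> y \<longrightarrow> affine hull {x, y} \<inter> convex hull A = {})"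

end

theory Submission
  imports Defs
begin

text \<open>
  Suppose two strict orders on \<open>S\<close> make every two points comparable in at least one of them. Call
  \<open>u < v\<close> dense if at least \<open>s\<close> points lie between them. If neither order has a chain of \<open>k\<close> dense
  steps, then ranking the points by dense chains in both orders splits \<open>S\<close> into \<open>k\<^sup>2\<close> classes
  without dense pairs; but a class much larger than \<open>s\<close> always has a dense pair. So for \<open>s\<close> of order
  \<open>|S| / k\<^sup>2\<close> there is a dense chain, and the points between its consecutive elements are the blocks.

  Ham-sandwich cuts yield four sets of size proportional to \<open>|P|\<close>, no three of which have a common
  line transversal. For such \<open>A\<close>, \<open>B\<close>, \<open>C\<close>, order \<open>A\<close> by angle as seen from all of \<open>B\<close>, respectively
  \<open>C\<close>: a line through two points of \<open>A\<close> misses the hull of \<open>B\<close> or that of \<open>C\<close>, so the first part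
  applies and gives blocks in \<open>A\<close> all of whose connecting lines avoid \<open>B\<close>, or all avoid \<open>C\<close>.
  With four sets, two must avoid each other.
\<close>

section \<open>Block-monotone chains for two orders\<close>

text \<open>Disjointness of the blocks is a consequence, through irreflexivity of the relation, and
  is derived where the blocks are used.\<close>

definition ordered_blocks :: "('a \<Rightarrow> 'a \<Rightarrow> bool) \<Rightarrow> 'a set \<Rightarrow> nat \<Rightarrow> nat \<Rightarrow> bool" where
  "ordered_blocks R S k s \<longleftrightarrow>
     (\<exists>A :: nat \<Rightarrow> 'a set.
        (\<forall>i\<in>{1..k}. A i \<subseteq> S \<and> s \<le> card (A i)) \<and>
        (\<forall>i\<in>{1..k}. \<forall>j\<in>{1..k}. i < j \<longrightarrow> (\<forall>a\<in>A i. \<forall>b\<in>A j. R a b)))"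

text \<open>Membership in \<open>S\<close> is built in so that chains, written as relational powers
  \<open>^^\<close>, stay inside \<open>S\<close>.\<close>

definition dense_pair :: "('a \<Rightarrow> 'a \<Rightarrow> bool) \<Rightarrow> 'a set \<Rightarrow> nat \<Rightarrow> 'a \<Rightarrow> 'a \<Rightarrow> bool" where
  "dense_pair R S s u v \<longleftrightarrow>
     u \<in> S \<and> v \<in> S \<and> R u v \<and> s \<le> card {w\<in>S. R u w \<and> R w v}"

text \<open>The blocks are the points between consecutive chain elements. A point of block
  \<open>i\<close> is below \<open>f i\<close>, which equals or precedes \<open>f (j - 1)\<close>,
  which is below every point of block \<open>j\<close>.\<close>

lemma ordered_blocks_if_dense_chain:
  assumes tr: "transp_on S R" and k: "0 < k"
    and chain: "(dense_pair R S s ^^ k) x y"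
  shows "ordered_blocks R S k s"
proof -
  obtain f where f: "\<And>i. i < k \<Longrightarrow> dense_pair R S s (f i) (f (Suc i))"
    using chain unfolding relpowp_fun_conv by blast
  have fS: "f i \<in> S" if "i \<le> k" for i
  proof (cases "i < k")
    case True
    then show ?thesis using f[of i] by (simp add: dense_pair_def)
  next
    case False
    then show ?thesis using that k f[of "k - 1"] by (simp add: dense_pair_def)
  qed
  have le: "f i = f j \<or> R (f i) (f j)" if "i \<le> j" "j \<le> k" for i j
    using that
  proof (induction rule: dec_induct)
    case (step n)
    then have "R (f n) (f (Suc n))" using f[of n] by (simp add: dense_pair_def)
    moreover have "f i \<in> S" "f n \<in> S" "f (Suc n) \<in> S" using step by (auto intro: fS)
    ultimately show ?case using step tr by (metis Suc_leD transp_onD)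
  qed auto
  define A where "A = (\<lambda>i. {w\<in>S. R (f (i - 1)) w \<and> R w (f i)})"
  have "A i \<subseteq> S \<and> s \<le> card (A i)" if "i \<in> {1..k}" for i
    using that f[of "i - 1"] by (auto simp: dense_pair_def A_def)
  moreover have "R a b" if "i \<in> {1..k}" "j \<in> {1..k}" "i < j" "a \<in> A i" "b \<in> A j" for i j a b
  proof -
    have ab: "a \<in> S" "b \<in> S" "R a (f i)" "R (f (j - 1)) b" using that by (auto simp: A_def)
    have "f i \<in> S" "f (j - 1) \<in> S" using that by (auto intro!: fS)
    moreover have "f i = f (j - 1) \<or> R (f i) (f (j - 1))" using that by (intro le) auto
    ultimately show ?thesis using ab tr by (metis transp_onD)
  qed
  ultimately show ?thesis unfolding ordered_blocks_def by blast
qed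

text \<open>Take for \<open>f v\<close> the least \<open>j\<close> such that no
  \<open>D\<close>-chain of \<open>j\<close> steps ends in \<open>v\<close>. It is positive because
  the empty chain always exists, and at most \<open>k\<close> by assumption.\<close>

lemma level_function_if_no_chain:
  assumes "\<And>x y. \<not> (D ^^ k) x y"
  obtains f :: "'a \<Rightarrow> nat" where "\<And>v. f v \<in> {1..k}" "\<And>u v. D u v \<Longrightarrow> f u < f v"
proof
  define H where "H = (\<lambda>j v. \<exists>u. (D ^^ j) u v)"
  define f where "f = (\<lambda>v. LEAST j. \<not> H j v)"
  have Hk: "\<not> H k v" for v using assms by (auto simp: H_def)
  have H0: "H 0 v" for v by (auto simp: H_def)
  have nH: "\<not> H (f v) v" for v unfolding f_def by (rule LeastI[of "\<lambda>j. \<not> H j v", OF Hk])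
  have lt: "H j v" if "j < f v" for j v using that not_less_Least unfolding f_def by blast
  have "f v \<noteq> 0" for v using nH[of v] H0 by metis
  moreover have "f v \<le> k" for v unfolding f_def by (rule Least_le) (rule Hk)
  ultimately show "f v \<in> {1..k}" for v by (simp add: Suc_le_eq)
  show "f u < f v" if "D u v" for u v
  proof (rule ccontr)
    assume n: "\<not> f u < f v"
    \<comment> \<open>If \<open>f u\<close> were at least \<open>f v\<close>, a chain of
      \<open>f v - 1\<close> steps would end in \<open>u\<close>, and the step from \<open>u\<close>
      to \<open>v\<close> would prolong it to the forbidden length.\<close>
    obtain i where i: "f v = Suc i" using \<open>f v \<noteq> 0\<close> not0_implies_Suc by blast
    then have "H i u" using n by (intro lt) auto
    then have "H (Suc i) v" using that by (auto simp: H_def)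
    then show False using nH[of v] i by simp
  qed
qed

section \<open>Size of sets without dense pairs\<close>

text \<open>Double counting: every pair in \<open>W \<times> W\<close> is diagonal or lies in one of
  the two relations or their converses, each of which has at most \<open>card W * s\<close> pairs.
  Dividing by \<open>card W\<close> gives the bound.\<close>

lemma card_le_if_few_predecessors:
  assumes fin: "finite W"
    and total: "\<And>x y. x \<in> W \<Longrightarrow> y \<in> W \<Longrightarrow> x \<noteq> y \<Longrightarrow> R x y \<or> R y x \<or> Q x y \<or> Q y x"
    and R: "\<And>w. w \<in> W \<Longrightarrow> card {x\<in>W. R x w} \<le> s"
    and Q: "\<And>w. w \<in> W \<Longrightarrow> card {x\<in>W. Q x w} \<le> s"
  shows "card W \<le> 4 * s + 1"
proof -
  \<comment> \<open>Pairs are listed with the \<open>R\<close>-larger element first, so that the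
    fibres are the predecessor sets.\<close>
  define E where "E = (\<lambda>R. Sigma W (\<lambda>y. {x\<in>W. R x y}))"
  have finE: "finite (E R)" for R using fin by (auto simp: E_def)
  have cE: "card (E R) \<le> card W * s" if "\<And>w. w \<in> W \<Longrightarrow> card {x\<in>W. R x w} \<le> s" for R
  proof -
    have "card (E R) = (\<Sum>y\<in>W. card {x\<in>W. R x y})"
      unfolding E_def using fin by (intro card_SigmaI) auto
    also have "\<dots> \<le> card W * s" using sum_bounded_above[OF that, of W] by simp
    finally show ?thesis .
  qed
  have cI: "card (Id_on W) \<le> card W"
  proof -
    have "Id_on W = (\<lambda>x. (x, x)) ` W" by (auto simp: Id_on_def)
    then show ?thesis using card_image_le[OF fin] by metis
  qed
  have cS: "card (prod.swap ` E R) \<le> card (E R)" for R by (rule card_image_le[OF finE])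
  have "W \<times> W \<subseteq> Id_on W \<union> (E R \<union> prod.swap ` E R) \<union> (E Q \<union> prod.swap ` E Q)"
  proof
    fix z assume "z \<in> W \<times> W"
    then obtain x y where z: "z = (x, y)" "x \<in> W" "y \<in> W" by auto
    have sw: "(x, y) \<in> prod.swap ` E T \<longleftrightarrow> (y, x) \<in> E T" for T
      by (metis image_iff swap_simp swap_swap)
    show "z \<in> Id_on W \<union> (E R \<union> prod.swap ` E R) \<union> (E Q \<union> prod.swap ` E Q)"
      unfolding z(1) Un_iff sw using z total[of x y] by (auto simp: E_def Id_on_def)
  qed
  then have "card (W \<times> W) \<le> card (Id_on W \<union> (E R \<union> prod.swap ` E R) \<union> (E Q \<union> prod.swap ` E Q))"
    using fin finE by (intro card_mono) (auto simp: Id_on_def)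
  also have "\<dots> \<le> card (Id_on W) + (card (E R) + card (prod.swap ` E R))
                     + (card (E Q) + card (prod.swap ` E Q))"
    by (intro card_Un_le[THEN order_trans] add_mono order_refl)
  also have "\<dots> \<le> card W + (card W * s + card W * s) + (card W * s + card W * s)"
    using cI cE[of R, OF R] cE[of Q, OF Q] cS[of R] cS[of Q] by linarith
  also have "\<dots> = card W * (4 * s + 1)" by (simp add: algebra_simps)
  finally have "card W * card W \<le> card W * (4 * s + 1)" by (simp only: card_cartesian_product)
  then show ?thesis by (metis gr0I le0 mult_le_cancel1)
qed

text \<open>If \<open>v0\<close> is \<open>R\<close>-maximal among the successors of \<open>p\<close>, then almost all of these are \<open>Q\<close>-comparable
  to \<open>v0\<close>, and each of the two resulting sets has few \<open>R\<close>-predecessors (because of \<open>p\<close>) and few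
  \<open>Q\<close>-predecessors or \<open>Q\<close>-successors (because of \<open>v0\<close>).\<close>

lemma card_successors_if_no_dense_pair:
  assumes fin: "finite U" and p: "p \<in> U"
    and R: "transp_on U R" "irreflp_on U R"
    and total: "\<And>x y. x \<in> U \<Longrightarrow> y \<in> U \<Longrightarrow> x \<noteq> y \<Longrightarrow> R x y \<or> R y x \<or> Q x y \<or> Q y x"
    and ndR: "\<And>u v. u \<in> U \<Longrightarrow> v \<in> U \<Longrightarrow> R u v \<Longrightarrow> card {w\<in>U. R u w \<and> R w v} \<le> s"
    and ndQ: "\<And>u v. u \<in> U \<Longrightarrow> v \<in> U \<Longrightarrow> Q u v \<Longrightarrow> card {w\<in>U. Q u w \<and> Q w v} \<le> s"
  shows "card {v\<in>U. R p v} \<le> 9 * s + 3"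
proof (cases "{v\<in>U. R p v} = {}")
  case False
  define V where "V = {v\<in>U. R p v}"
  have VU: "V \<subseteq> U" and finV: "finite V" using fin by (auto simp: V_def)
  have "transp_on V R" using R(1) VU by (rule transp_on_subset)
  moreover have "asymp_on V R"
  proof (rule asymp_onI)
    fix x y assume "x \<in> V" "y \<in> V" "R x y"
    then show "\<not> R y x"
      using transp_onD[OF R(1), of x y x] irreflp_onD[OF R(2), of x] VU by blast
  qed
  ultimately obtain v0 where v0: "v0 \<in> V" "\<And>x. x \<in> V \<Longrightarrow> x \<noteq> v0 \<Longrightarrow> \<not> R v0 x"
    using Finite_Set.bex_max_element[OF finV, of R] False unfolding V_def by blast
  \<comment> \<open>Since \<open>p\<close> precedes all of \<open>V\<close>, the
    \<open>R\<close>-predecessors of \<open>v\<close> in \<open>V\<close> lie between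
    \<open>p\<close> and \<open>v\<close>.\<close>
  have down: "card {x\<in>V'. R x v} \<le> s" if "V' \<subseteq> V" "v \<in> V" for v V'
  proof -
    have "card {x\<in>V'. R x v} \<le> card {w\<in>U. R p w \<and> R w v}"
      using fin that by (intro card_mono) (auto simp: V_def)
    also have "\<dots> \<le> s" using that p by (intro ndR) (auto simp: V_def)
    finally show ?thesis .
  qed
  have W1: "card {x\<in>V. Q v0 x} \<le> 4 * s + 1"
  proof (rule card_le_if_few_predecessors[where R = R and Q = Q])
    fix w assume w: "w \<in> {x\<in>V. Q v0 x}"
    then show "card {x \<in> {x\<in>V. Q v0 x}. R x w} \<le> s" by (intro down) auto
    have "card {x \<in> {x\<in>V. Q v0 x}. Q x w} \<le> card {x\<in>U. Q v0 x \<and> Q x w}"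
      using fin VU by (intro card_mono) auto
    also have "\<dots> \<le> s" using w v0 VU by (intro ndQ) auto
    finally show "card {x \<in> {x\<in>V. Q v0 x}. Q x w} \<le> s" .
  qed (use finV total VU in auto)
  have W2: "card {x\<in>V. Q x v0} \<le> 4 * s + 1"
  \<comment> \<open>Below \<open>v0\<close>, betweenness bounds the \<open>Q\<close>-successors of
    \<open>w\<close>, so the counting is done with \<open>Q\<close> reversed.\<close>
  proof (rule card_le_if_few_predecessors[where R = R and Q = "\<lambda>x y. Q y x"])
    fix w assume w: "w \<in> {x\<in>V. Q x v0}"
    then show "card {x \<in> {x\<in>V. Q x v0}. R x w} \<le> s" by (intro down) auto
    have "card {x \<in> {x\<in>V. Q x v0}. Q w x} \<le> card {x\<in>U. Q w x \<and> Q x v0}"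
      using fin VU by (intro card_mono) auto
    also have "\<dots> \<le> s" using w v0 VU by (intro ndQ) auto
    finally show "card {x \<in> {x\<in>V. Q x v0}. Q w x} \<le> s" .
  next
    fix x y assume "x \<in> {x\<in>V. Q x v0}" "y \<in> {x\<in>V. Q x v0}" "x \<noteq> y"
    then show "R x y \<or> R y x \<or> Q y x \<or> Q x y" using total[of x y] VU by auto
  qed (use finV in auto)
  \<comment> \<open>Maximality of \<open>v0\<close> excludes \<open>R\<close>-successors, which
    leaves \<open>1 + s + 2 * (4 * s + 1) = 9 * s + 3\<close> points.\<close>
  have "V \<subseteq> {v0} \<union> {x\<in>V. R x v0} \<union> {x\<in>V. Q v0 x} \<union> {x\<in>V. Q x v0}"
    using v0 total VU by blast
  then have "card V \<le> card ({v0} \<union> {x\<in>V. R x v0} \<union> {x\<in>V. Q v0 x} \<union> {x\<in>V. Q x v0})"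
    using finV by (intro card_mono) auto
  also have "\<dots> \<le> card {v0} + card {x\<in>V. R x v0} + card {x\<in>V. Q v0 x} + card {x\<in>V. Q x v0}"
    by (intro card_Un_le[THEN order_trans] add_mono order_refl)
  also have "\<dots> \<le> 1 + s + (4 * s + 1) + (4 * s + 1)"
    using W1 W2 down[of V v0] v0 by (intro add_mono) auto
  finally show ?thesis by (simp add: V_def)
next
  case True
  show ?thesis unfolding True by simp
qed

text \<open>All points other than a fixed \<open>p\<close> are successors or predecessors of
  \<open>p\<close> in one of the two orders. The previous bound for \<open>R\<close>,
  \<open>Q\<close> and their converses gives \<open>4 * (9 * s + 3) + 1\<close>.\<close>

lemma card_le_if_no_dense_pair:
  assumes fin: "finite U"
    and R: "transp_on U R" "irreflp_on U R" and Q: "transp_on U Q" "irreflp_on U Q"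
    and total: "\<And>x y. x \<in> U \<Longrightarrow> y \<in> U \<Longrightarrow> x \<noteq> y \<Longrightarrow> R x y \<or> R y x \<or> Q x y \<or> Q y x"
    and ndR: "\<And>u v. u \<in> U \<Longrightarrow> v \<in> U \<Longrightarrow> R u v \<Longrightarrow> card {w\<in>U. R u w \<and> R w v} \<le> s"
    and ndQ: "\<And>u v. u \<in> U \<Longrightarrow> v \<in> U \<Longrightarrow> Q u v \<Longrightarrow> card {w\<in>U. Q u w \<and> Q w v} \<le> s"
  shows "card U \<le> 36 * s + 13"
proof (cases "U = {}")
  case False
  then obtain p where p: "p \<in> U" by blast
  have conv: "transp_on U (\<lambda>x y. T y x)" "irreflp_on U (\<lambda>x y. T y x)"
    if "transp_on U T" "irreflp_on U T" for T
    using that unfolding transp_on_def irreflp_on_def by blast+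
  have ndR': "card {w\<in>U. R w u \<and> R v w} \<le> s" if "u \<in> U" "v \<in> U" "R v u" for u v
    using ndR[of v u] that by (simp add: conj_commute)
  have ndQ': "card {w\<in>U. Q w u \<and> Q v w} \<le> s" if "u \<in> U" "v \<in> U" "Q v u" for u v
    using ndQ[of v u] that by (simp add: conj_commute)
  have 1: "card {v\<in>U. R p v} \<le> 9 * s + 3"
    by (rule card_successors_if_no_dense_pair[OF fin p R total ndR ndQ])
  have 2: "card {v\<in>U. Q p v} \<le> 9 * s + 3"
    by (rule card_successors_if_no_dense_pair[OF fin p Q _ ndQ ndR]) (use total in blast)
  have 3: "card {v\<in>U. R v p} \<le> 9 * s + 3"
    by (rule card_successors_if_no_dense_pair[OF fin p conv[OF R] _ ndR' ndQ]) (use total in blast)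
  have 4: "card {v\<in>U. Q v p} \<le> 9 * s + 3"
    by (rule card_successors_if_no_dense_pair[OF fin p conv[OF Q] _ ndQ' ndR]) (use total in blast)
  have "U \<subseteq> {p} \<union> {v\<in>U. R p v} \<union> {v\<in>U. Q p v} \<union> {v\<in>U. R v p} \<union> {v\<in>U. Q v p}"
    using total p by blast
  then have "card U \<le> card ({p} \<union> {v\<in>U. R p v} \<union> {v\<in>U. Q p v} \<union> {v\<in>U. R v p} \<union> {v\<in>U. Q v p})"
    using fin by (intro card_mono) auto
  also have "\<dots> \<le> card {p} + card {v\<in>U. R p v} + card {v\<in>U. Q p v} + card {v\<in>U. R v p}
                     + card {v\<in>U. Q v p}"
    by (intro card_Un_le[THEN order_trans] add_mono order_refl)
  finally show ?thesis using 1 2 3 4 by simp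
qed simp

text \<open>Without blocks there are no dense chains of \<open>k\<close> steps, so both orders have
  level functions with values in \<open>{1..k}\<close>. Levels increase along dense pairs, so none
  of the \<open>k\<^sup>2\<close> joint fibres contains such a pair, and each fibre is
  small.\<close>

lemma ordered_blocks_of_two_orders:
  assumes fin: "finite S" and k: "0 < k"
    and R: "transp_on S R" "irreflp_on S R" and Q: "transp_on S Q" "irreflp_on S Q"
    and total: "\<And>x y. x \<in> S \<Longrightarrow> y \<in> S \<Longrightarrow> x \<noteq> y \<Longrightarrow> R x y \<or> R y x \<or> Q x y \<or> Q y x"
    and card: "k\<^sup>2 * (36 * s + 13) < card S"
  shows "ordered_blocks R S k s \<or> ordered_blocks Q S k s"
proof (rule ccontr)
  assume neg: "\<not> ?thesis"
  obtain f where f: "\<And>v. f v \<in> {1..k}" "\<And>u v. dense_pair R S s u v \<Longrightarrow> f u < f v"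
    using level_function_if_no_chain[of k "dense_pair R S s"]
      ordered_blocks_if_dense_chain[OF R(1) k] neg by metis
  obtain g where g: "\<And>v. g v \<in> {1..k}" "\<And>u v. dense_pair Q S s u v \<Longrightarrow> g u < g v"
    using level_function_if_no_chain[of k "dense_pair Q S s"]
      ordered_blocks_if_dense_chain[OF Q(1) k] neg by metis
  have fibre: "card {v\<in>S. (f v, g v) = z} \<le> 36 * s + 13" for z
  proof (rule card_le_if_no_dense_pair[where R = R and Q = Q])
    let ?U = "{v\<in>S. (f v, g v) = z}"
    show "card {w\<in>?U. R u w \<and> R w v} \<le> s" if "u \<in> ?U" "v \<in> ?U" "R u v" for u v
    proof -
      have "\<not> dense_pair R S s u v" using f(2)[of u v] that by auto
      then have "card {w\<in>S. R u w \<and> R w v} \<le> s" using that by (auto simp: dense_pair_def)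
      \<comment> \<open>Density is measured in \<open>S\<close>; inside a fibre even fewer points
        lie between \<open>u\<close> and \<open>v\<close>.\<close>
      moreover have "card {w\<in>?U. R u w \<and> R w v} \<le> card {w\<in>S. R u w \<and> R w v}"
        using fin by (intro card_mono) auto
      ultimately show ?thesis by linarith
    qed
    show "card {w\<in>?U. Q u w \<and> Q w v} \<le> s" if "u \<in> ?U" "v \<in> ?U" "Q u v" for u v
    proof -
      have "\<not> dense_pair Q S s u v" using g(2)[of u v] that by auto
      then have "card {w\<in>S. Q u w \<and> Q w v} \<le> s" using that by (auto simp: dense_pair_def)
      moreover have "card {w\<in>?U. Q u w \<and> Q w v} \<le> card {w\<in>S. Q u w \<and> Q w v}"
        using fin by (intro card_mono) auto
      ultimately show ?thesis by linarith
    qed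
    show "transp_on ?U R" "transp_on ?U Q" "irreflp_on ?U R" "irreflp_on ?U Q"
      using R Q by (auto elim: transp_on_subset irreflp_on_subset)
  qed (use fin total in auto)
  let ?K = "{1..k} \<times> {1..k}"
  have "S \<subseteq> (\<Union>z\<in>?K. {v\<in>S. (f v, g v) = z})" using f(1) g(1) by auto
  then have "card S \<le> card (\<Union>z\<in>?K. {v\<in>S. (f v, g v) = z})"
    using fin by (intro card_mono) auto
  also have "\<dots> \<le> (\<Sum>z\<in>?K. card {v\<in>S. (f v, g v) = z})"
    by (rule card_UN_le) simp
  also have "\<dots> \<le> card ?K * (36 * s + 13)"
    using sum_bounded_above[of ?K "\<lambda>z. card {v\<in>S. (f v, g v) = z}"] fibre by simp
  also have "\<dots> = k\<^sup>2 * (36 * s + 13)" by (simp add: card_cartesian_product power2_eq_square)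
  finally show False using card by linarith
qed

section \<open>Orientation of planar triples\<close>

text \<open>Twice the signed area of the triangle \<open>a b c\<close>: positive for a
  counterclockwise turn, zero exactly for collinear triples.\<close>

definition orient :: "real^2 \<Rightarrow> real^2 \<Rightarrow> real^2 \<Rightarrow> real" where
  "orient a b c = (b$1 - a$1) * (c$2 - a$2) - (b$2 - a$2) * (c$1 - a$1)"

text \<open>\<open>B\<close> lies strictly to the left of the directed line from \<open>a\<close> to
  \<open>a'\<close>. As a relation in \<open>a\<close> and \<open>a'\<close> this is the angular
  order common to all viewpoints in \<open>B\<close>.\<close>

definition sees :: "(real^2) set \<Rightarrow> real^2 \<Rightarrow> real^2 \<Rightarrow> bool" where
  "sees B a a' \<longleftrightarrow> (\<forall>b\<in>B. 0 < orient a a' b)"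

text \<open>A line meeting all three hulls amounts to a collinear triple with one point in each
  hull.\<close>

definition no_transversal :: "(real^2) set \<Rightarrow> (real^2) set \<Rightarrow> (real^2) set \<Rightarrow> bool" where
  "no_transversal A B C \<longleftrightarrow>
     (\<forall>a\<in>convex hull A. \<forall>b\<in>convex hull B. \<forall>c\<in>convex hull C. orient a b c \<noteq> 0)"

definition left_of :: "(real^2) set \<Rightarrow> (real^2) set \<Rightarrow> bool" where
  "left_of A B \<longleftrightarrow> (\<forall>a\<in>A. \<forall>b\<in>B. a$1 < b$1)"

lemma affine_pos_on_convex_hull:
  fixes F :: "'a::real_vector \<Rightarrow> real"
  assumes F: "\<And>u v p q. u + v = 1 \<Longrightarrow> F (u *\<^sub>R p + v *\<^sub>R q) = u * F p + v * F q"
    and pos: "\<And>p. p \<in> W \<Longrightarrow> 0 < F p" and p: "p \<in> convex hull W"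
  shows "0 < F p"
proof -
  have "convex {p. 0 < F p}"
  proof (rule convexI)
    fix x y and u v :: real
    assume "x \<in> {p. 0 < F p}" "y \<in> {p. 0 < F p}" "0 \<le> u" "0 \<le> v" "u + v = 1"
    then show "u *\<^sub>R x + v *\<^sub>R y \<in> {p. 0 < F p}"
      using convex_bound_lt[of "- F x" 0 "- F y" u v] by (simp add: F)
  qed
  then have "convex hull W \<subseteq> {p. 0 < F p}" using pos by (intro hull_minimal) auto
  then show ?thesis using p by blast
qed

lemma orient_affine:
  assumes "u + v = 1"
  shows "orient a b (u *\<^sub>R c + v *\<^sub>R d) = u * orient a b c + v * orient a b d"
proof -
  have v: "v = 1 - u" using assms by simp
  show ?thesis unfolding v orient_def by (simp add: algebra_simps)
qed

lemma orient_pos_convex_hull: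
  assumes "sees B a a'" "b \<in> convex hull B"
  shows "0 < orient a a' b"
proof (rule affine_pos_on_convex_hull[where F = "orient a a'" and W = B])
qed (use assms in \<open>auto simp: orient_affine sees_def\<close>)

text \<open>The affine functional \<open>orient a a'\<close> vanishes on the line through
  \<open>a\<close> and \<open>a'\<close> but has a strict sign on the hull of
  \<open>B\<close>.\<close>

lemma affine_hull_disjoint_if_sees:
  assumes "sees B a a' \<or> sees B a' a" "B' \<subseteq> B"
  shows "affine hull {a, a'} \<inter> convex hull B' = {}"
proof -
  have z: "orient a a' p = 0" "orient a' a p = 0" if p: "p \<in> affine hull {a, a'}" for p
  proof -
    obtain u v where uv: "p = u *\<^sub>R a + v *\<^sub>R a'" "u + v = 1" using p unfolding affine_hull_2 by blast
    then show "orient a a' p = 0" "orient a' a p = 0"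
      by (simp_all only: orient_affine) (simp_all add: orient_def)
  qed
  have "convex hull B' \<subseteq> convex hull B" using assms(2) by (rule hull_mono)
  then show ?thesis using z assms(1) orient_pos_convex_hull by fastforce
qed

text \<open>If neither direction sees \<open>B\<close>, then \<open>B\<close> has points on both
  closed sides of the line, and the segment joining them meets it.\<close>

lemma orient_eq_0_in_convex_hull:
  assumes "\<not> sees B a a'" "\<not> sees B a' a"
  obtains b where "b \<in> convex hull B" "orient a a' b = 0"
proof -
  have sw: "orient a' a b = - orient a a' b" for b by (simp add: orient_def algebra_simps)
  obtain b1 b2 where b: "b1 \<in> B" "orient a a' b1 \<le> 0" "b2 \<in> B" "0 \<le> orient a a' b2"
    using assms by (auto simp: sees_def sw not_less)
  show ?thesis
  proof (cases "orient a a' b1 = 0")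
    case True
    then show ?thesis using that b hull_inc by metis
  next
    case False
    define d where "d = orient a a' b2 - orient a a' b1"
    have d: "0 < d" using False b by (auto simp: d_def)
    \<comment> \<open>The weights of the zero of an affine function on the segment, computed from
      its two end values.\<close>
    define u where "u = orient a a' b2 / d"
    define v where "v = - orient a a' b1 / d"
    have uv: "u + v = 1" "0 \<le> u" "0 \<le> v"
      using d b by (auto simp: u_def v_def d_def divide_simps)
    have "u *\<^sub>R b1 + v *\<^sub>R b2 \<in> convex hull B"
      using uv b by (intro convexD[OF convex_convex_hull]) (auto intro: hull_inc)
    moreover have "orient a a' (u *\<^sub>R b1 + v *\<^sub>R b2) = u * orient a a' b1 + v * orient a a' b2"
      by (rule orient_affine[OF uv(1)])
    then have "orient a a' (u *\<^sub>R b1 + v *\<^sub>R b2) = 0" by (simp add: u_def v_def)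
    ultimately show ?thesis using that by blast
  qed
qed

text \<open>Both \<open>b\<close> and \<open>c\<close> lie on the line through \<open>a\<close> and
  \<open>a'\<close>. Algebraically, both coordinates of \<open>a' - a\<close> annihilate
  \<open>orient a b c\<close>, and one of them is nonzero.\<close>

lemma orient_eq_0_trans:
  assumes "a \<noteq> a'" "orient a a' b = 0" "orient a a' c = 0"
  shows "orient a b c = 0"
proof -
  have "(a'$1 - a$1) * orient a b c = 0" "(a'$2 - a$2) * orient a b c = 0"
    using assms(2,3) unfolding orient_def by algebra+
  moreover have "a'$1 - a$1 \<noteq> 0 \<or> a'$2 - a$2 \<noteq> 0"
    using assms(1) by (auto simp: vec_eq_iff forall_2)
  ultimately show ?thesis by auto
qed

lemma no_transversal_subset:
  assumes "no_transversal A B C" "A' \<subseteq> A" "B' \<subseteq> B" "C' \<subseteq> C"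
  shows "no_transversal A' B' C'"
  using assms hull_mono[of A' A convex] hull_mono[of B' B convex] hull_mono[of C' C convex]
  unfolding no_transversal_def by blast

text \<open>\<open>orient\<close> is alternating. These two permutations bring the second and the
  third set to the front, the place of the set that is to be ordered.\<close>

lemma no_transversal_perm:
  assumes "no_transversal A B C"
  shows "no_transversal B A C" "no_transversal C A B"
proof -
  have eq: "orient a c b = - orient a b c" "orient b a c = - orient a b c" for a b c
    by (simp_all add: orient_def algebra_simps)
  have flip: "no_transversal A C B" "no_transversal B A C" if nt: "no_transversal A B C" for A B C
  proof -
    have "orient a c b \<noteq> 0 \<and> orient b a c \<noteq> 0"
      if "a \<in> convex hull A" "b \<in> convex hull B" "c \<in> convex hull C" for a b c
    proof -
      have "orient a b c \<noteq> 0" using nt that unfolding no_transversal_def by blast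
      then show ?thesis using eq(1)[of a c b] eq(2)[of b a c] by linarith
    qed
    then show "no_transversal A C B" "no_transversal B A C" unfolding no_transversal_def by blast+
  qed
  show "no_transversal B A C" "no_transversal C A B"
    using flip(2)[OF assms] flip(2)[OF flip(1)[OF assms]] by blast+
qed

section \<open>Angular orders seen from separated sets\<close>

text \<open>From a viewpoint \<open>b\<close>, all of \<open>A\<close> lies on one side of the
  vertical line through \<open>b\<close>, so angles around \<open>b\<close> cannot wrap
  around.\<close>

lemma transp_on_sees:
  assumes "left_of A B \<or> left_of B A"
  shows "transp_on A (sees B)"
proof (rule transp_onI)
  fix x y z assume A: "x \<in> A" "y \<in> A" "z \<in> A" and s: "sees B x y" "sees B y z"
  show "sees B x z"
    unfolding sees_def
  proof
    fix b assume b: "b \<in> B"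
    have p: "0 < orient x y b" "0 < orient y z b" using s b by (auto simp: sees_def)
    \<comment> \<open>A linear relation among the three orientations whose coefficients are
      horizontal distances to \<open>b\<close>; separation gives these a common sign.\<close>
    have id: "(b$1 - y$1) * orient x z b = (b$1 - z$1) * orient x y b + (b$1 - x$1) * orient y z b"
      by (simp add: orient_def algebra_simps)
    show "0 < orient x z b"
      using assms
    proof
      assume "left_of A B"
      then have l: "0 < b$1 - x$1" "0 < b$1 - y$1" "0 < b$1 - z$1" using A b by (auto simp: left_of_def)
      then have "0 < (b$1 - y$1) * orient x z b" unfolding id using p by (intro add_pos_pos mult_pos_pos)
      then show ?thesis using l zero_less_mult_pos by blast
    next
      assume "left_of B A"
      then have l: "b$1 - x$1 < 0" "b$1 - y$1 < 0" "b$1 - z$1 < 0" using A b by (auto simp: left_of_def)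
      then have "(b$1 - y$1) * orient x z b < 0" unfolding id using p
        by (intro add_neg_neg mult_neg_pos)
      then show ?thesis using l by (metis mult_less_0_iff order.asym)
    qed
  qed
qed

text \<open>Two points comparable in neither order would span a line meeting the hulls of
  \<open>B\<close> and \<open>C\<close>, hence a transversal of the three sets.\<close>

lemma ordered_blocks_sees:
  assumes fin: "finite A" and k: "0 < k" and ne: "B \<noteq> {}" "C \<noteq> {}"
    and sep: "left_of A B \<or> left_of B A" "left_of A C \<or> left_of C A"
    and nt: "no_transversal A B C"
    and card: "k\<^sup>2 * (36 * s + 13) < card A"
  shows "ordered_blocks (sees B) A k s \<or> ordered_blocks (sees C) A k s"
proof (rule ordered_blocks_of_two_orders[OF fin k _ _ _ _ _ card])
  show "transp_on A (sees B)" "transp_on A (sees C)" using sep by (auto intro: transp_on_sees)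
  show "irreflp_on A (sees B)" "irreflp_on A (sees C)"
    using ne by (auto intro!: irreflp_onI simp: sees_def orient_def)
  fix x y assume xy: "x \<in> A" "y \<in> A" "x \<noteq> y"
  show "sees B x y \<or> sees B y x \<or> sees C x y \<or> sees C y x"
  proof (rule ccontr)
    assume n: "\<not> ?thesis"
    obtain b where b: "b \<in> convex hull B" "orient x y b = 0"
      using orient_eq_0_in_convex_hull n by blast
    obtain c where c: "c \<in> convex hull C" "orient x y c = 0"
      using orient_eq_0_in_convex_hull n by blast
    have "orient x b c = 0" using orient_eq_0_trans xy b c by blast
    then show False using nt b c hull_inc[OF xy(1)] by (auto simp: no_transversal_def)
  qed
qed

section \<open>Ham-sandwich cuts of separated sets\<close>

text \<open>The lower median: the least attained value such that at least half of \<open>X\<close>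
  lies at or below it.\<close>

definition median :: "'a set \<Rightarrow> ('a \<Rightarrow> real) \<Rightarrow> real" where
  "median X f = Min {v\<in>f ` X. card X \<le> 2 * card {p\<in>X. f p \<le> v}}"

context
  fixes X :: "'a set"
  assumes fin: "finite X" and ne: "X \<noteq> {}"
begin

lemma median_mem: "median X f \<in> {v\<in>f ` X. card X \<le> 2 * card {p\<in>X. f p \<le> v}}"
proof -
  have "{p\<in>X. f p \<le> Max (f ` X)} = X" using fin by auto
  then have "Max (f ` X) \<in> {v\<in>f ` X. card X \<le> 2 * card {p\<in>X. f p \<le> v}}"
    using fin ne by auto
  then show ?thesis unfolding median_def using fin by (intro Min_in) auto
qed

text \<open>The bound \<open>v\<close> may fail to be attained, so it is first lowered to the
  largest attained value below it, which captures the same points.\<close>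

lemma median_le:
  assumes "card X \<le> 2 * card {p\<in>X. f p \<le> v}"
  shows "median X f \<le> v"
proof -
  let ?L = "{p\<in>X. f p \<le> v}"
  have L: "?L \<noteq> {}" "finite ?L"
    using assms fin ne by (metis card.empty card_gt_0_iff mult_0_right not_le) (simp add: fin)
  let ?v = "Max (f ` ?L)"
  have v: "?v \<in> f ` ?L" using L by (intro Max_in) auto
  moreover have "?L \<subseteq> {p\<in>X. f p \<le> ?v}" using L by auto
  then have "card ?L \<le> card {p\<in>X. f p \<le> ?v}" using fin by (intro card_mono) auto
  ultimately have "median X f \<le> ?v"
    unfolding median_def using fin assms by (intro Min_le) auto
  also have "?v \<le> v" using v by auto
  finally show ?thesis .
qed

text \<open>Otherwise at least half of the points are strictly below the median, and the largest of
  their values would be a smaller candidate.\<close>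

lemma median_ge_half: "card X \<le> 2 * card {p\<in>X. median X f \<le> f p}"
proof (rule ccontr)
  assume n: "\<not> ?thesis"
  let ?m = "median X f"
  let ?L = "{p\<in>X. f p < ?m}"
  have "card X \<le> card (?L \<union> {p\<in>X. ?m \<le> f p})" using fin by (intro card_mono) auto
  then have "card X \<le> card ?L + card {p\<in>X. ?m \<le> f p}" using card_Un_le order_trans by blast
  then have c: "card X \<le> 2 * card ?L" using n by linarith
  have L: "?L \<noteq> {}" "finite ?L"
    using c fin ne by (metis card.empty card_gt_0_iff mult_0_right not_le) (simp add: fin)
  let ?v = "Max (f ` ?L)"
  have "?v \<in> f ` ?L" using L by (intro Max_in) auto
  then have "?v < ?m" by auto
  moreover have "card ?L \<le> card {p\<in>X. f p \<le> ?v}" using fin L by (intro card_mono) auto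
  then have "?m \<le> ?v" using c by (intro median_le) linarith
  ultimately show False by linarith
qed

lemma median_le_shift:
  assumes "\<And>p. p \<in> X \<Longrightarrow> g p \<le> f p + d"
  shows "median X g \<le> median X f + d"
proof (rule median_le)
  have "card X \<le> 2 * card {p\<in>X. f p \<le> median X f}" using median_mem[of f] by simp
  also have "card {p\<in>X. f p \<le> median X f} \<le> card {p\<in>X. g p \<le> median X f + d}"
    using fin by (intro card_mono) (auto intro: order_trans[OF assms])
  finally show "card X \<le> 2 * card {p\<in>X. g p \<le> median X f + d}" by simp
qed

text \<open>Changing \<open>t\<close> by \<open>d\<close> moves every value by at most
  \<open>K * \<bar>d\<bar>\<close>, hence also the median: it is Lipschitz in
  \<open>t\<close>.\<close>

lemma continuous_on_median: "continuous_on UNIV (\<lambda>t. median X (\<lambda>p. f p - t * g p))"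
proof -
  define K where "K = Max ((\<lambda>p. \<bar>g p\<bar>) ` X)"
  have K: "\<bar>g p\<bar> \<le> K" if "p \<in> X" for p unfolding K_def using fin that by (intro Max_ge) auto
  have K0: "0 \<le> K" using K ne by (metis abs_ge_zero all_not_in_conv order_trans)
  have le: "median X (\<lambda>p. f p - t * g p) \<le> median X (\<lambda>p. f p - t' * g p) + K * \<bar>t - t'\<bar>" for t t'
  proof (rule median_le_shift)
    fix p assume "p \<in> X"
    have "(t' - t) * g p \<le> \<bar>g p\<bar> * \<bar>t - t'\<bar>"
      by (metis abs_ge_self abs_minus_commute abs_mult mult.commute)
    also have "\<dots> \<le> K * \<bar>t - t'\<bar>" using K \<open>p \<in> X\<close> by (intro mult_right_mono) auto
    finally show "f p - t * g p \<le> f p - t' * g p + K * \<bar>t - t'\<bar>" by (simp add: algebra_simps)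
  qed
  have "K-lipschitz_on UNIV (\<lambda>t. median X (\<lambda>p. f p - t * g p))"
  proof (rule lipschitz_onI[OF _ K0])
    fix t t' :: real
    show "dist (median X (\<lambda>p. f p - t * g p)) (median X (\<lambda>p. f p - t' * g p)) \<le> K * dist t t'"
      using le[of t t'] le[of t' t] by (simp add: dist_real_def abs_le_iff abs_minus_commute algebra_simps)
  qed
  then show ?thesis by (rule lipschitz_on_continuous_on)
qed

end

text \<open>For each slope \<open>t\<close> compare the heights of the median lines of
  \<open>X\<close> and \<open>Z\<close>. The order of the heights is reversed between two extreme
  slopes, so at some slope the lines coincide.\<close>

lemma ham_sandwich:
  assumes X: "finite X" "X \<noteq> {}" and Z: "finite Z" "Z \<noteq> {}" and sep: "left_of X Z"
  obtains t h where
    "card X \<le> 2 * card {p\<in>X. p$2 - t * p$1 \<le> h}" "card X \<le> 2 * card {p\<in>X. h \<le> p$2 - t * p$1}"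
    "card Z \<le> 2 * card {p\<in>Z. p$2 - t * p$1 \<le> h}" "card Z \<le> 2 * card {p\<in>Z. h \<le> p$2 - t * p$1}"
proof -
  define m where "m = (\<lambda>S t. median S (\<lambda>p :: real^2. p$2 - t * p$1))"
  have mX: "m X t \<in> (\<lambda>p. p$2 - t * p$1) ` X" for t using median_mem[OF X] by (auto simp: m_def)
  have mZ: "m Z t \<in> (\<lambda>p. p$2 - t * p$1) ` Z" for t using median_mem[OF Z] by (auto simp: m_def)
  \<comment> \<open>The largest absolute slope of a line joining \<open>X\<close> to
    \<open>Z\<close>. Medians are attained at points, so at slopes \<open>T\<close> and
    \<open>-T\<close> the comparison reduces to single pairs.\<close>
  define T where "T = Max ((\<lambda>(p, q). \<bar>(q$2 - p$2) / (q$1 - p$1)\<bar>) ` (X \<times> Z))"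
  have T: "\<bar>q$2 - p$2\<bar> \<le> T * (q$1 - p$1)" if "p \<in> X" "q \<in> Z" for p q
  proof -
    have "\<bar>(q$2 - p$2) / (q$1 - p$1)\<bar> \<le> T"
      unfolding T_def using X Z that by (intro Max_ge) (auto intro!: image_eqI[of _ _ "(p, q)"])
    moreover have "0 < q$1 - p$1" using sep that by (auto simp: left_of_def)
    ultimately show ?thesis by (simp add: abs_div_pos[symmetric] divide_le_eq)
  qed
  have T0: "-T \<le> T"
  proof -
    obtain p q where "p \<in> X" "q \<in> Z" using X Z by blast
    then have "0 \<le> T * (q$1 - p$1)" "0 < q$1 - p$1"
      using T[of p q] sep by (auto simp: left_of_def)
    then have "0 \<le> T" by (simp add: zero_le_mult_iff)
    then show ?thesis by simp
  qed
  have hi: "m Z T \<le> m X T"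
  proof -
    obtain p q where "p \<in> X" "q \<in> Z" "m X T = p$2 - T * p$1" "m Z T = q$2 - T * q$1"
      using mX[of T] mZ[of T] by auto
    then show ?thesis using T[of p q] by (simp add: algebra_simps abs_le_iff)
  qed
  have lo: "m X (-T) \<le> m Z (-T)"
  proof -
    obtain p q where "p \<in> X" "q \<in> Z" "m X (-T) = p$2 - (-T) * p$1" "m Z (-T) = q$2 - (-T) * q$1"
      using mX[of "-T"] mZ[of "-T"] by auto
    then show ?thesis using T[of p q] by (simp add: algebra_simps abs_le_iff)
  qed
  have "continuous_on {-T..T} (\<lambda>t. m X t - m Z t)"
    unfolding m_def
    by (intro continuous_on_diff
        continuous_on_subset[OF continuous_on_median[OF X, of "\<lambda>p. p$2" "\<lambda>p. p$1"]]
        continuous_on_subset[OF continuous_on_median[OF Z, of "\<lambda>p. p$2" "\<lambda>p. p$1"]]) auto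
  then obtain t where "m X t - m Z t = 0"
    using IVT'[of "\<lambda>t. m X t - m Z t" "-T" 0 T] hi lo T0 by auto
  then have eq: "m Z t = m X t" by simp
  show ?thesis
  proof (rule that[where t = t and h = "m X t"])
    show "card X \<le> 2 * card {p\<in>X. p$2 - t * p$1 \<le> m X t}"
      using median_mem[OF X] by (simp add: m_def)
    show "card X \<le> 2 * card {p\<in>X. m X t \<le> p$2 - t * p$1}"
      using median_ge_half[OF X] by (simp add: m_def)
    show "card Z \<le> 2 * card {p\<in>Z. p$2 - t * p$1 \<le> m X t}"
      unfolding eq[symmetric] using median_mem[OF Z] by (simp add: m_def)
    show "card Z \<le> 2 * card {p\<in>Z. m X t \<le> p$2 - t * p$1}"
      unfolding eq[symmetric] using median_ge_half[OF Z] by (simp add: m_def)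
  qed
qed

section \<open>Four sets without line transversals to three of them\<close>

lemma general_position_card_line:
  fixes d :: "real^2"
  assumes "general_position P" "L \<subseteq> P" "\<And>p q. p \<in> L \<Longrightarrow> q \<in> L \<Longrightarrow> \<exists>c. p - q = c *\<^sub>R d"
  shows "card L \<le> 2"
proof (rule ccontr)
  assume "\<not> card L \<le> 2"
  then have "3 \<le> card L" by simp
  then obtain T where T: "T \<subseteq> L" "card T = 3" by (metis obtain_subset_with_card_n)
  then obtain x y z where xyz: "T = {x, y, z}" "x \<noteq> y" "x \<noteq> z" "y \<noteq> z" by (auto simp: card_3_iff)
  have "collinear T" unfolding collinear_def using assms(3) T by blast
  then show False using assms(1,2) T xyz by (auto simp: general_position_def)
qed

text \<open>On a transversal the point of the middle hull lies between the other two, but the line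
  of slope \<open>t\<close> separates it from both. The factor \<open>s\<close> selects the
  side.\<close>

lemma no_transversal_if_separated:
  fixes s t h :: real
  assumes sep: "left_of X Y" "left_of Y Z"
    and X: "\<And>p. p \<in> X \<Longrightarrow> s * (p$2 - t * p$1 - h) < 0"
    and Y: "\<And>p. p \<in> Y \<Longrightarrow> 0 < s * (p$2 - t * p$1 - h)"
    and Z: "\<And>p. p \<in> Z \<Longrightarrow> s * (p$2 - t * p$1 - h) < 0"
  shows "no_transversal X Y Z"
proof -
  define F where "F = (\<lambda>p :: real^2. s * (p$2 - t * p$1 - h))"
  have comb: "F (u *\<^sub>R p + v *\<^sub>R q) = u * F p + v * F q" if "u + v = 1" for u v p q
  proof -
    have v: "v = 1 - u" using that by simp
    show ?thesis unfolding v F_def by (simp add: algebra_simps)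
  qed
  have pos: "0 < F p" if "p \<in> convex hull W" "\<And>p. p \<in> W \<Longrightarrow> 0 < F p" for p W
    by (rule affine_pos_on_convex_hull[where F = F and W = W]) (use comb that in auto)
  have neg: "F p < 0" if "p \<in> convex hull W" "\<And>p. p \<in> W \<Longrightarrow> F p < 0" for p W
    using affine_pos_on_convex_hull[where F = "\<lambda>p. - F p" and W = W and p = p] comb that by auto
  have hull_left: "left_of (convex hull V) (convex hull W)" if "left_of V W" for V W
  proof -
    have c1: "convex {x::real^2. x$1 < c}" for c
      using convex_halfspace_lt[of "axis 1 1 :: real^2" c] by (simp add: inner_axis')
    have c2: "convex {x::real^2. c < x$1}" for c
      using convex_halfspace_gt[of c "axis 1 1 :: real^2"] by (simp add: inner_axis')
    \<comment> \<open>Hulls are taken one at a time: first that of \<open>V\<close> against single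
      points of \<open>W\<close>, then that of \<open>W\<close>.\<close>
    have 1: "convex hull V \<subseteq> {x. x$1 < w$1}" if "w \<in> W" for w
      using \<open>left_of V W\<close> that by (intro hull_minimal c1) (auto simp: left_of_def)
    have "convex hull W \<subseteq> {x. v$1 < x$1}" if "v \<in> convex hull V" for v
      using 1 that by (intro hull_minimal c2) blast
    then show ?thesis by (auto simp: left_of_def)
  qed
  show ?thesis
    unfolding no_transversal_def
  proof (intro ballI notI)
    fix a b c assume abc: "a \<in> convex hull X" "b \<in> convex hull Y" "c \<in> convex hull Z"
      and o: "orient a b c = 0"
    have lt: "a$1 < b$1" "b$1 < c$1"
      using hull_left[OF sep(1)] hull_left[OF sep(2)] abc by (auto simp: left_of_def)
    have F: "F a < 0" "0 < F b" "F c < 0" using neg pos X Y Z abc unfolding F_def by blast+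
    \<comment> \<open>Collinearity makes \<open>F b\<close> a weighted mean of \<open>F a\<close>
      and \<open>F c\<close>, with positive weights.\<close>
    have "(c$1 - a$1) * F b = (c$1 - b$1) * F a + (b$1 - a$1) * F c"
      using o unfolding F_def orient_def by algebra
    moreover have "0 < (c$1 - a$1) * F b" using lt F by (intro mult_pos_pos) auto
    moreover have "(c$1 - b$1) * F a < 0" "(b$1 - a$1) * F c < 0"
      using lt F by (auto intro: mult_pos_neg)
    ultimately show False by linarith
  qed
qed

text \<open>Halve \<open>X\<close> and \<open>Z\<close> by one line, keep a side of it rich in
  \<open>Y\<close>, and keep the opposite sides of \<open>X\<close> and \<open>Z\<close>. The line
  carries at most two points of each set; from 8 points on, half minus two is at least a
  quarter.\<close>

lemma no_transversal_subsets:
  assumes gp: "general_position P" and fin: "finite P" and sub: "X \<subseteq> P" "Y \<subseteq> P" "Z \<subseteq> P"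
    and sep: "left_of X Y" "left_of Y Z" "left_of X Z"
    and card: "8 \<le> card X" "8 \<le> card Y" "8 \<le> card Z"
  obtains X' Y' Z' where "X' \<subseteq> X" "Y' \<subseteq> Y" "Z' \<subseteq> Z" "no_transversal X' Y' Z'"
    "card X \<le> 4 * card X'" "card Y \<le> 4 * card Y'" "card Z \<le> 4 * card Z'"
proof -
  have finX: "finite X" and finY: "finite Y" and finZ: "finite Z"
    using fin sub by (auto intro: finite_subset)
  have ne: "X \<noteq> {}" "Z \<noteq> {}" using card by auto
  obtain t h where th:
    "card X \<le> 2 * card {p\<in>X. p$2 - t * p$1 \<le> h}" "card X \<le> 2 * card {p\<in>X. h \<le> p$2 - t * p$1}"
    "card Z \<le> 2 * card {p\<in>Z. p$2 - t * p$1 \<le> h}" "card Z \<le> 2 * card {p\<in>Z. h \<le> p$2 - t * p$1}"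
    by (rule ham_sandwich[OF finX ne(1) finZ ne(2) sep(3)])
  have line: "card {p\<in>W. p$2 - t * p$1 = h} \<le> 2" if "W \<subseteq> P" for W
  proof (rule general_position_card_line[OF gp, where d = "vector [1, t]"])
    fix p q assume pq: "p \<in> {p\<in>W. p$2 - t * p$1 = h}" "q \<in> {p\<in>W. p$2 - t * p$1 = h}"
    have "p - q = (p$1 - q$1) *\<^sub>R vector [1, t]"
      using pq by (auto simp: vec_eq_iff forall_2 vector_2 algebra_simps)
    then show "\<exists>c. p - q = c *\<^sub>R vector [1, t]" by blast
  qed (use that in auto)
  define lo where "lo = (\<lambda>W :: (real^2) set. {p\<in>W. p$2 - t * p$1 < h})"
  define hi where "hi = (\<lambda>W :: (real^2) set. {p\<in>W. h < p$2 - t * p$1})"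
  have cl: "card {p\<in>W. p$2 - t * p$1 \<le> h} \<le> card (lo W) + 2" if "W \<subseteq> P" for W
  proof -
    have "{p\<in>W. p$2 - t * p$1 \<le> h} = lo W \<union> {p\<in>W. p$2 - t * p$1 = h}" by (auto simp: lo_def)
    then show ?thesis using card_Un_le[of "lo W" "{p\<in>W. p$2 - t * p$1 = h}"] line[OF that] by simp
  qed
  have ch: "card {p\<in>W. h \<le> p$2 - t * p$1} \<le> card (hi W) + 2" if "W \<subseteq> P" for W
  proof -
    have "{p\<in>W. h \<le> p$2 - t * p$1} = hi W \<union> {p\<in>W. p$2 - t * p$1 = h}" by (auto simp: hi_def)
    then show ?thesis using card_Un_le[of "hi W" "{p\<in>W. p$2 - t * p$1 = h}"] line[OF that] by simp
  qed
  have "card Y \<le> card (lo Y \<union> {p\<in>Y. h \<le> p$2 - t * p$1})"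
    using finY by (intro card_mono) (auto simp: lo_def)
  then have cY: "card Y \<le> card (lo Y) + card {p\<in>Y. h \<le> p$2 - t * p$1}"
    using card_Un_le order_trans by blast
  have cXZ: "card X \<le> 4 * card (lo X)" "card X \<le> 4 * card (hi X)"
    "card Z \<le> 4 * card (lo Z)" "card Z \<le> 4 * card (hi Z)"
    using th cl[OF sub(1)] cl[OF sub(3)] ch[OF sub(1)] ch[OF sub(3)] card by linarith+
  have lohi: "lo W \<subseteq> W" "hi W \<subseteq> W" for W by (auto simp: lo_def hi_def)
  show ?thesis
  proof (cases "card Y \<le> 4 * card (lo Y)")
    case True
    have "no_transversal (hi X) (lo Y) (hi Z)"
      by (rule no_transversal_if_separated[where s = "-1" and t = t and h = h])
        (use sep in \<open>auto simp: lo_def hi_def left_of_def\<close>)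
    then show ?thesis using that[of "hi X" "lo Y" "hi Z"] lohi True cXZ by blast
  next
    case False
    then have "card Y \<le> 4 * card (hi Y)" using ch[OF sub(2)] cY card by linarith
    moreover have "no_transversal (lo X) (hi Y) (lo Z)"
      by (rule no_transversal_if_separated[where s = "1" and t = t and h = h])
        (use sep in \<open>auto simp: lo_def hi_def left_of_def\<close>)
    ultimately show ?thesis using that[of "lo X" "hi Y" "lo Z"] lohi cXZ by blast
  qed
qed

section \<open>Vertical strips and successive shrinking\<close>

lemma obtain_leftmost:
  fixes X :: "(real^2) set"
  assumes "finite X" "inj_on (\<lambda>p. p$1) X" "q \<le> card X"
  obtains Y where "Y \<subseteq> X" "card Y = q" "left_of Y (X - Y)"
proof -
  have "\<exists>Y\<subseteq>X. card Y = q \<and> left_of Y (X - Y)"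
    using assms(3)
  proof (induction q)
    case 0
    then show ?case by (intro exI[of _ "{}"]) (auto simp: left_of_def)
  next
    case (Suc q)
    then obtain Y where Y: "Y \<subseteq> X" "card Y = q" "left_of Y (X - Y)" by auto
    have fin: "finite (X - Y)" "finite Y" using assms(1) Y finite_subset by auto
    have "X - Y \<noteq> {}" using Suc.prems Y by auto
    then obtain z where z: "z \<in> X - Y" "\<And>x. x \<in> X - Y \<Longrightarrow> z$1 \<le> x$1"
      using ex_is_arg_min_if_finite[OF fin(1), of "\<lambda>p. p$1"] by (metis is_arg_min_linorder)
    have "z$1 < x$1" if "x \<in> X - insert z Y" for x
      using that z assms(2) by (metis DiffD1 DiffD2 DiffI inj_onD insertCI le_less)
    then have "left_of (insert z Y) (X - insert z Y)" using Y by (auto simp: left_of_def)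
    moreover have "card (insert z Y) = Suc q" using fin z Y by simp
    ultimately show ?case using Y z by (intro exI[of _ "insert z Y"]) auto
  qed
  then show ?thesis using that by blast
qed

text \<open>Choose one point on each occupied vertical line; general position puts at most two on
  each.\<close>

lemma obtain_distinct_abscissas:
  assumes "general_position P" "finite P"
  obtains P' where "P' \<subseteq> P" "inj_on (\<lambda>p. p$1) P'" "card P \<le> 2 * card P'"
proof -
  obtain P' where P': "P' \<subseteq> P" "inj_on (\<lambda>p. p$1) P'" "(\<lambda>p. p$1) ` P' = (\<lambda>p. p$1) ` P"
    using subset_image_inj[of "(\<lambda>p. p$1) ` P" "\<lambda>p. p$1" P] by (metis subset_refl)
  have fib: "card {p\<in>P. p$1 = x} \<le> 2" for x
  proof (rule general_position_card_line[OF assms(1), where d = "vector [0, 1]"])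
    fix p q assume pq: "p \<in> {p\<in>P. p$1 = x}" "q \<in> {p\<in>P. p$1 = x}"
    have "p - q = (p$2 - q$2) *\<^sub>R vector [0, 1]"
      using pq by (auto simp: vec_eq_iff forall_2 vector_2)
    then show "\<exists>c. p - q = c *\<^sub>R vector [0, 1]" by blast
  qed auto
  let ?I = "(\<lambda>p. p$1) ` P"
  have "P = (\<Union>x\<in>?I. {p\<in>P. p$1 = x})" by auto
  then have "card P \<le> (\<Sum>x\<in>?I. card {p\<in>P. p$1 = x})"
    using card_UN_le[of ?I "\<lambda>x. {p\<in>P. p$1 = x}"] assms(2) by simp
  also have "\<dots> \<le> card ?I * 2" using sum_bounded_above[of ?I "\<lambda>x. card {p\<in>P. p$1 = x}" 2] fib by simp
  also have "card ?I = card P'" using card_image[OF P'(2)] P'(3) by simp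
  finally show ?thesis using that P' by simp
qed

lemma obtain_four_strips:
  assumes "general_position P" "finite P"
  obtains A B C D where "A \<subseteq> P" "B \<subseteq> P" "C \<subseteq> P" "D \<subseteq> P"
    "left_of A B" "left_of A C" "left_of A D" "left_of B C" "left_of B D" "left_of C D"
    "card P \<le> 8 * card A + 6" "card B = card A" "card C = card A" "card D = card A"
proof -
  obtain P' where P': "P' \<subseteq> P" "inj_on (\<lambda>p. p$1) P'" "card P \<le> 2 * card P'"
    using obtain_distinct_abscissas[OF assms] .
  \<comment> \<open>Rounding loses at most 3 points of \<open>P'\<close>, whence
    \<open>card P \<le> 2 * (4 * q + 3)\<close>.\<close>
  define q where "q = card P' div 4"
  have q4: "4 * q \<le> card P'" "card P' \<le> 4 * q + 3" by (auto simp: q_def)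
  have finP: "finite P'" using P' assms finite_subset by blast
  have inj: "inj_on (\<lambda>p. p$1) W" if "W \<subseteq> P'" for W using P'(2) that by (rule inj_on_subset)
  obtain A where A: "A \<subseteq> P'" "card A = q" "left_of A (P' - A)"
    using obtain_leftmost[OF finP P'(2), of q] q4 by auto
  have cA: "card (P' - A) = card P' - q" using A finP by (simp add: card_Diff_subset finite_subset)
  obtain B where B: "B \<subseteq> P' - A" "card B = q" "left_of B (P' - A - B)"
    by (rule obtain_leftmost[of "P' - A" q]) (use finP inj[of "P' - A"] q4 cA in auto)
  have cB: "card (P' - A - B) = card P' - q - q"
    using B finP cA by (simp add: card_Diff_subset finite_subset)
  obtain C where C: "C \<subseteq> P' - A - B" "card C = q" "left_of C (P' - A - B - C)"
    by (rule obtain_leftmost[of "P' - A - B" q]) (use finP inj[of "P' - A - B"] q4 cB in auto)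
  have cC: "card (P' - A - B - C) = card P' - q - q - q"
    using C finP cB by (simp add: card_Diff_subset finite_subset)
  then have "q \<le> card (P' - A - B - C)" using q4 by linarith
  then obtain D where D: "D \<subseteq> P' - A - B - C" "card D = q"
    using obtain_subset_with_card_n by metis
  show ?thesis
  proof (rule that[of A B C D])
    show "left_of A B" "left_of A C" "left_of A D" "left_of B C" "left_of B D" "left_of C D"
      using A B C D unfolding left_of_def by blast+
    show "card P \<le> 8 * card A + 6" using P'(3) q4 A by linarith
  qed (use A B C D P'(1) in auto)
qed

text \<open>The four strips are shrunk once for each of the four triples, and subsets keep what was
  achieved before. Each set takes part in three shrinkings, so the factor is
  \<open>8 * 4 ^ 3 = 512\<close>; with 1100 points every set still has 8 after two of them.\<close>

lemma obtain_four_sets: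
  assumes gp: "general_position P" and fin: "finite P" and large: "1100 \<le> card P"
  obtains A B C D where "A \<subseteq> P" "B \<subseteq> P" "C \<subseteq> P" "D \<subseteq> P"
    "left_of A B" "left_of A C" "left_of A D" "left_of B C" "left_of B D" "left_of C D"
    "no_transversal A B C" "no_transversal A B D" "no_transversal A C D" "no_transversal B C D"
    "card P \<le> 512 * card A + 6" "card P \<le> 512 * card B + 6"
    "card P \<le> 512 * card C + 6" "card P \<le> 512 * card D + 6"
proof -
  obtain A B C D where S: "A \<subseteq> P" "B \<subseteq> P" "C \<subseteq> P" "D \<subseteq> P"
    and l: "left_of A B" "left_of A C" "left_of A D" "left_of B C" "left_of B D" "left_of C D"
    and c: "card P \<le> 8 * card A + 6" "card B = card A" "card C = card A" "card D = card A"
    using obtain_four_strips[OF gp fin] by metis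
  have lo: "left_of V' W'" if "left_of V W" "V' \<subseteq> V" "W' \<subseteq> W" for V W V' W'
    using that by (auto simp: left_of_def)
  obtain A1 B1 C1 where 1: "A1 \<subseteq> A" "B1 \<subseteq> B" "C1 \<subseteq> C" "no_transversal A1 B1 C1"
    "card A \<le> 4 * card A1" "card B \<le> 4 * card B1" "card C \<le> 4 * card C1"
    by (rule no_transversal_subsets[OF gp fin, of A B C]) (use S l c large in auto)
  obtain A2 B2 D2 where 2: "A2 \<subseteq> A1" "B2 \<subseteq> B1" "D2 \<subseteq> D" "no_transversal A2 B2 D2"
    "card A1 \<le> 4 * card A2" "card B1 \<le> 4 * card B2" "card D \<le> 4 * card D2"
  proof (rule no_transversal_subsets[OF gp fin, of A1 B1 D])
    show "left_of A1 B1" "left_of B1 D" "left_of A1 D" using l lo 1 by blast+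
  qed (use S 1 c large in auto)
  obtain A3 C3 D3 where 3: "A3 \<subseteq> A2" "C3 \<subseteq> C1" "D3 \<subseteq> D2" "no_transversal A3 C3 D3"
    "card A2 \<le> 4 * card A3" "card C1 \<le> 4 * card C3" "card D2 \<le> 4 * card D3"
  proof (rule no_transversal_subsets[OF gp fin, of A2 C1 D2])
    show "left_of A2 C1" "left_of C1 D2" "left_of A2 D2" using l lo 1 2 by (meson subset_trans)+
  qed (use S 1 2 c large in auto)
  obtain B4 C4 D4 where 4: "B4 \<subseteq> B2" "C4 \<subseteq> C3" "D4 \<subseteq> D3" "no_transversal B4 C4 D4"
    "card B2 \<le> 4 * card B4" "card C3 \<le> 4 * card C4" "card D3 \<le> 4 * card D4"
  proof (rule no_transversal_subsets[OF gp fin, of B2 C3 D3])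
    show "left_of B2 C3" "left_of C3 D3" "left_of B2 D3" using l lo 1 2 3 by (meson subset_trans)+
  qed (use S 1 2 3 c large in auto)
  have sub: "A3 \<subseteq> A" "B4 \<subseteq> B" "C4 \<subseteq> C" "D4 \<subseteq> D" using 1 2 3 4 by blast+
  show ?thesis
  proof (rule that[of A3 B4 C4 D4])
    show "A3 \<subseteq> P" "B4 \<subseteq> P" "C4 \<subseteq> P" "D4 \<subseteq> P" using sub S by blast+
    show "left_of A3 B4" "left_of A3 C4" "left_of A3 D4" "left_of B4 C4" "left_of B4 D4" "left_of C4 D4"
      using l lo sub by blast+
    show "no_transversal A3 B4 C4" by (rule no_transversal_subset[OF 1(4)]) (use 2 3 4 in auto)
    show "no_transversal A3 B4 D4" by (rule no_transversal_subset[OF 2(4)]) (use 3 4 in auto)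
    show "no_transversal A3 C4 D4" by (rule no_transversal_subset[OF 3(4)]) (use 4 in auto)
    show "no_transversal B4 C4 D4" by (rule 4)
    show "card P \<le> 512 * card A3 + 6" "card P \<le> 512 * card B4 + 6"
      "card P \<le> 512 * card C4 + 6" "card P \<le> 512 * card D4 + 6"
      using c 1(5-7) 2(5-7) 3(5-7) 4(5-7) by linarith+
  qed
qed

section \<open>Blocks that see each other, and the conclusion\<close>

lemma obtain_mutually_seeing_blocks:
  assumes gp: "general_position P" and fin: "finite P" and k: "0 < k"
    and s: "0 < s" "50000 * k\<^sup>2 * s \<le> card P"
  obtains (sets) X Y where "X \<subseteq> P" "Y \<subseteq> P" "X \<inter> Y = {}" "X \<noteq> {}" "Y \<noteq> {}"
    "ordered_blocks (sees Y) X k s" "ordered_blocks (sees X) Y k s"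
proof -
  have k2s: "1 \<le> k\<^sup>2 * s" using k s by (simp add: Suc_le_eq)
  then have "1100 \<le> card P" using s(2) by linarith
  then obtain A B C D
    where S: "A \<subseteq> P" "B \<subseteq> P" "C \<subseteq> P" "D \<subseteq> P"
    and l: "left_of A B" "left_of A C" "left_of A D" "left_of B C" "left_of B D" "left_of C D"
    and nt: "no_transversal A B C" "no_transversal A B D" "no_transversal A C D" "no_transversal B C D"
    and c: "card P \<le> 512 * card A + 6" "card P \<le> 512 * card B + 6"
    "card P \<le> 512 * card C + 6" "card P \<le> 512 * card D + 6"
    by (rule obtain_four_sets[OF gp fin])
  \<comment> \<open>Since \<open>s\<close> is positive, \<open>36 * s + 13 \<le> 49 * s\<close>; the
    constant 50000 exceeds \<open>512 * 49 + 6\<close>.\<close>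
  have large: "k\<^sup>2 * (36 * s + 13) < card W" if "card P \<le> 512 * card W + 6" for W :: "(real^2) set"
  proof -
    have "k\<^sup>2 * (36 * s + 13) \<le> k\<^sup>2 * (49 * s)" using s(1) by (intro mult_left_mono) auto
    also have "\<dots> = 49 * (k\<^sup>2 * s)" by simp
    also have "\<dots> < card W" using that s(2) k2s by linarith
    finally show ?thesis .
  qed
  have cs: "k\<^sup>2 * (36 * s + 13) < card A" "k\<^sup>2 * (36 * s + 13) < card B"
    "k\<^sup>2 * (36 * s + 13) < card C" "k\<^sup>2 * (36 * s + 13) < card D" using c large by blast+
  have fins: "finite A" "finite B" "finite C" "finite D" using S fin finite_subset by blast+
  have ne: "A \<noteq> {}" "B \<noteq> {}" "C \<noteq> {}" "D \<noteq> {}" using cs by auto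
  define G where "G = (\<lambda>X Y. ordered_blocks (sees Y) X k s)"
  have blk: "G X Y \<or> G X Z"
    if "finite X" "Y \<noteq> {}" "Z \<noteq> {}" "left_of X Y \<or> left_of Y X" "left_of X Z \<or> left_of Z X"
      "no_transversal X Y Z" "k\<^sup>2 * (36 * s + 13) < card X" for X Y Z
    unfolding G_def by (rule ordered_blocks_sees[OF that(1) k that(2-)])
  note nts = nt nt[THEN no_transversal_perm(1)] nt[THEN no_transversal_perm(2)]
  have "G A B \<or> G A C" "G A B \<or> G A D" "G A C \<or> G A D"
    "G B A \<or> G B C" "G B A \<or> G B D" "G B C \<or> G B D"
    "G C A \<or> G C B" "G C A \<or> G C D" "G C B \<or> G C D"
    "G D A \<or> G D B" "G D A \<or> G D C" "G D B \<or> G D C"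
    by - (rule blk; simp only: fins ne l nts cs simp_thms not_False_eq_True)+
  \<comment> \<open>Each of the four sets is good towards all but at most one of the others: at least 8 of
    the 12 ordered pairs are good, so some two of them are opposite.\<close>
  then have "G A B \<and> G B A \<or> G A C \<and> G C A \<or> G A D \<and> G D A \<or>
      G B C \<and> G C B \<or> G B D \<and> G D B \<or> G C D \<and> G D C"
    by argo
  moreover have disj: "X \<inter> Y = {}" if "left_of X Y" for X Y using that by (force simp: left_of_def)
  have result: ?thesis
    if XY: "X \<subseteq> P" "Y \<subseteq> P" "left_of X Y" "X \<noteq> {}" "Y \<noteq> {}" "G X Y \<and> G Y X" for X Y
    by (rule sets[of X Y]) (use XY disj[of X Y] in \<open>simp_all add: G_def\<close>)
  ultimately show ?thesis
    using result[OF S(1,2) l(1) ne(1,2)] result[OF S(1,3) l(2) ne(1,3)] result[OF S(1,4) l(3) ne(1,4)]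
      result[OF S(2,3) l(4) ne(2,3)] result[OF S(2,4) l(5) ne(2,4)] result[OF S(3,4) l(6) ne(3,4)]
    by argo
qed

theorem theorem1p3:
  "\<exists>c0::real. c0 > 0 \<and>
     (\<forall>k::nat. k > 0 \<longrightarrow>
       (\<exists>(\<epsilon>::real) (n::nat). \<epsilon> \<ge> c0 / (real k)^2 \<and>
         (\<forall>P::(real^2) set. finite P \<and> general_position P \<and> card P \<ge> n \<longrightarrow>
           (\<exists>A B :: nat \<Rightarrow> (real^2) set.
              (\<forall>i\<in>{1..k}. A i \<subseteq> P \<and> B i \<subseteq> P) \<and>
              disjoint_family_on A {1..k} \<and>
              disjoint_family_on B {1..k} \<and>
              (\<forall>i\<in>{1..k}. \<forall>j\<in>{1..k}. A i \<inter> B j = {}) \<and>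
              (\<forall>i\<in>{1..k}. real (card (A i)) \<ge> \<epsilon> * real (card P) \<and>
                          real (card (B i)) \<ge> \<epsilon> * real (card P)) \<and>
              (\<forall>a b :: nat \<Rightarrow> real^2.
                 (\<forall>i\<in>{1..k}. a i \<in> A i \<and> b i \<in> B i) \<longrightarrow>
                 mutually_avoiding (a ` {1..k}) (b ` {1..k}))))))"
proof (rule exI[of _ "1 / 100000"], intro conjI allI impI, goal_cases)
  case (2 k)
  then have k: "0 < k" .
  show ?case
  proof (rule exI[of _ "(1 / 100000) / (real k)^2"], rule exI[of _ "50000 * k\<^sup>2"],
      intro conjI allI impI order_refl, goal_cases)
    case (1 P)
    then have P: "finite P \<and> general_position P \<and> 50000 * k\<^sup>2 \<le> card P" .
    let ?\<epsilon> = "(1 / 100000) / (real k)^2"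
    \<comment> \<open>The common block size. As \<open>s\<close> is at least 1, rounding down loses
      less than a factor 2, which turns 50000 into the 100000 of the density.\<close>
    define s where "s = card P div (50000 * k\<^sup>2)"
    have K: "0 < 50000 * k\<^sup>2" using k by simp
    have s0: "0 < s" using P K by (simp add: s_def div_greater_zero_iff)
    have s1: "50000 * k\<^sup>2 * s \<le> card P" unfolding s_def by simp
    have "card P < 50000 * k\<^sup>2 * (s + 1)"
      unfolding s_def using K by (metis Suc_eq_plus1 dividend_less_times_div mult_Suc_right add.commute)
    also have "\<dots> \<le> 50000 * k\<^sup>2 * (2 * s)" using s0 by (intro mult_left_mono) auto
    finally have "card P \<le> 100000 * k\<^sup>2 * s" by simp
    then have "real (card P) \<le> real (100000 * k\<^sup>2 * s)" by (simp only: of_nat_le_iff)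
    then have s2: "?\<epsilon> * real (card P) \<le> real s" using k by (simp add: field_simps)
    obtain X Y where XY: "X \<subseteq> P" "Y \<subseteq> P" "X \<inter> Y = {}" "X \<noteq> {}" "Y \<noteq> {}"
      "ordered_blocks (sees Y) X k s" "ordered_blocks (sees X) Y k s"
      using obtain_mutually_seeing_blocks[OF _ _ k s0 s1] P by metis
    obtain A where A: "\<And>i. i \<in> {1..k} \<Longrightarrow> A i \<subseteq> X" "\<And>i. i \<in> {1..k} \<Longrightarrow> s \<le> card (A i)"
      "\<And>i j a b. i \<in> {1..k} \<Longrightarrow> j \<in> {1..k} \<Longrightarrow> i < j \<Longrightarrow> a \<in> A i \<Longrightarrow> b \<in> A j \<Longrightarrow> sees Y a b"
      using XY(6) unfolding ordered_blocks_def by metis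
    obtain B where B: "\<And>i. i \<in> {1..k} \<Longrightarrow> B i \<subseteq> Y" "\<And>i. i \<in> {1..k} \<Longrightarrow> s \<le> card (B i)"
      "\<And>i j a b. i \<in> {1..k} \<Longrightarrow> j \<in> {1..k} \<Longrightarrow> i < j \<Longrightarrow> a \<in> B i \<Longrightarrow> b \<in> B j \<Longrightarrow> sees X a b"
      using XY(7) unfolding ordered_blocks_def by metis
    have irr: "\<not> sees W x x" if "W \<noteq> {}" for W x using that by (auto simp: sees_def orient_def)
    \<comment> \<open>A point common to two blocks would be related to itself, which is impossible
      for nonempty \<open>W\<close>.\<close>
    have disj: "disjoint_family_on F {1..k}"
      if "W \<noteq> {}" "\<And>i j a b. i \<in> {1..k} \<Longrightarrow> j \<in> {1..k} \<Longrightarrow> i < j \<Longrightarrow> a \<in> F i \<Longrightarrow> b \<in> F j \<Longrightarrow> sees W a b"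
      for F W
      unfolding disjoint_family_on_def
    proof (intro ballI impI)
      fix m n assume mn: "m \<in> {1..k}" "n \<in> {1..k}" "m \<noteq> n"
      then have "m < n \<or> n < m" by auto
      then show "F m \<inter> F n = {}" using that(2) irr[OF that(1)] mn by blast
    qed
    have avoid: "affine hull {x, y} \<inter> convex hull (b ` {1..k}) = {}"
      if F: "\<And>i j a b. i \<in> {1..k} \<Longrightarrow> j \<in> {1..k} \<Longrightarrow> i < j \<Longrightarrow> a \<in> F i \<Longrightarrow> b \<in> F j \<Longrightarrow> sees W a b"
        and a: "\<And>i. i \<in> {1..k} \<Longrightarrow> a i \<in> F i" and b: "\<And>i. i \<in> {1..k} \<Longrightarrow> b i \<in> W"
        and xy: "x \<in> a ` {1..k}" "y \<in> a ` {1..k}" "x \<noteq> y" for F W a b x y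
    proof (rule affine_hull_disjoint_if_sees[of W])
      obtain i j where ij: "i \<in> {1..k}" "j \<in> {1..k}" "x = a i" "y = a j" using xy by auto
      \<comment> \<open>Distinct points come from distinct blocks, and the order of the indices
        decides the direction of \<open>sees\<close>.\<close>
      then have "i \<noteq> j" using xy(3) by auto
      then have "i < j \<or> j < i" by linarith
      then show "sees W x y \<or> sees W y x" using F a ij by metis
      show "b ` {1..k} \<subseteq> W" using b by auto
    qed
    show ?case
    proof (rule exI[of _ A], rule exI[of _ B], intro conjI allI impI)
      show "\<forall>i\<in>{1..k}. A i \<subseteq> P \<and> B i \<subseteq> P" using A(1) B(1) XY by blast
      show "disjoint_family_on A {1..k}" by (rule disj[OF XY(5)]) (use A(3) in blast)
      show "disjoint_family_on B {1..k}" by (rule disj[OF XY(4)]) (use B(3) in blast)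
      show "\<forall>i\<in>{1..k}. \<forall>j\<in>{1..k}. A i \<inter> B j = {}" using A(1) B(1) XY(3) by blast
      show "\<forall>i\<in>{1..k}. real (card (A i)) \<ge> ?\<epsilon> * real (card P) \<and>
                          real (card (B i)) \<ge> ?\<epsilon> * real (card P)"
        using A(2) B(2) s2 by (meson of_nat_le_iff order_trans)
      fix a b :: "nat \<Rightarrow> real^2"
      assume ab: "\<forall>i\<in>{1..k}. a i \<in> A i \<and> b i \<in> B i"
      have inA: "a i \<in> A i" "a i \<in> X" and inB: "b i \<in> B i" "b i \<in> Y" if "i \<in> {1..k}" for i
        using ab that A(1) B(1) by blast+
      show "mutually_avoiding (a ` {1..k}) (b ` {1..k})"
        unfolding mutually_avoiding_def
      proof (intro conjI ballI impI)
        fix x y assume "x \<in> a ` {1..k}" "y \<in> a ` {1..k}" "x \<noteq> y"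
        then show "affine hull {x, y} \<inter> convex hull (b ` {1..k}) = {}"
          by (intro avoid[where F = A and W = Y]) (use A(3) inA inB in blast)+
      next
        fix x y assume "x \<in> b ` {1..k}" "y \<in> b ` {1..k}" "x \<noteq> y"
        then show "affine hull {x, y} \<inter> convex hull (a ` {1..k}) = {}"
          by (intro avoid[where F = B and W = X]) (use B(3) inA inB in blast)+
      qed
    qed
  qed
qed simp

end
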